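(* Let $(X,\mathcal{A},\lambda)$ be a $\sigma$-finite measure space and $T:X\to X$ a null-preserving map, and assume that there is a $T$-invariant probability measure $\mu\ll\lambda$ on $\mathcal{A}$ (i.e. $\mu\circ T^{-1}=\mu$). Then the system $(X,\mathcal{A},\lambda,T)$ is exact if and only if $$A\in\mathcal{A}\ \text{and}\ \lambda(A)>0\quad\text{imply}\quad \mu(\hat{T}^nA)\longrightarrow 1\ \text{ as } n\to\infty .$$ If (in the exact case) $\mu$ is moreover equivalent to $\lambda$ (mutually absolutely continuous) and $\lambda(X)=1$, then also $\lambda(\hat{T}^nA)\to 1$ as $n\to\infty$ for every $A\in\mathcal{A}$ with $\lambda(A)>0$.
   Context: For $A,B\in\mathcal{A}$ write $A\overset{.}{\subseteq}B$ if $\lambda(A\setminus B)=0$ and $A\overset{.}{=}B$ if $\lambda(A\triangle B)=0$. A measurable map $T:X\to X$ is null-preserving if $\lambda(A)=0$ implies $\lambda(T^{-1}A)=0$ for $A\in\mathcal{A}$. An essential image of $A\in\mathcal{A}$ under $T$ is a set $A'\in\mathcal{A}$ such that $T^{-1}A'\overset{.}{\supseteq}A$ and such that every $B'\in\mathcal{A}$ with $T^{-1}B'\overset{.}{\supseteq}A$ satisfies $B'\overset{.}{\supseteq}A'$. In the present ($\sigma$-finite, null-preserving) setting every $A\in\mathcal{A}$ has essential images and they form exactly one equivalence class under $\overset{.}{=}$; $\hat{T}A$ denotes an arbitrary fixed essential image of $A$, and $\hat{T}^n$ is the $n$-fold iterate ($\hat{T}^0A=A$). A tail set is a set $A\in\mathcal{A}$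 with $A\overset{.}{=}B$ for some $B\in\bigcap_{n\ge 0}T^{-n}\mathcal{A}$. The system is exact if every tail set $A$ satisfies $\lambda(A)=0$ or $\lambda(A^c)=0$. *)

theory Defs
  imports "HOL-Probability.Probability"
begin

definition ae_subset :: "'a measure \<Rightarrow> 'a set \<Rightarrow> 'a set \<Rightarrow> bool" where
  "ae_subset M A B \<longleftrightarrow> emeasure M (A - B) = 0"

definition ae_equal :: "'a measure \<Rightarrow> 'a set \<Rightarrow> 'a set \<Rightarrow> bool" where
  "ae_equal M A B \<longleftrightarrow> emeasure M ((A - B) \<union> (B - A)) = 0"

definition null_preserving :: "'a measure \<Rightarrow> ('a \<Rightarrow> 'a) \<Rightarrow> bool" where
  "null_preserving M T \<longleftrightarrow> T \<in> measurable M M \<and>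
     (\<forall>A\<in>sets M. emeasure M A = 0 \<longrightarrow> emeasure M (T -` A \<inter> space M) = 0)"

definition essential_image :: "'a measure \<Rightarrow> ('a \<Rightarrow> 'a) \<Rightarrow> 'a set \<Rightarrow> 'a set \<Rightarrow> bool" where
  "essential_image M T A A' \<longleftrightarrow> A' \<in> sets M \<and> ae_subset M A (T -` A' \<inter> space M) \<and>
     (\<forall>B'\<in>sets M. ae_subset M A (T -` B' \<inter> space M) \<longrightarrow> ae_subset M A' B')"

definition tail_set :: "'a measure \<Rightarrow> ('a \<Rightarrow> 'a) \<Rightarrow> 'a set \<Rightarrow> bool" where
  "tail_set M T A \<longleftrightarrow> A \<in> sets M \<and>
     (\<exists>B\<in>(\<Inter>n. {(T ^^ n) -` C \<inter> space M | C. C \<in> sets M}). ae_equal M A B)"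

definition exact_system :: "'a measure \<Rightarrow> ('a \<Rightarrow> 'a) \<Rightarrow> bool" where
  "exact_system M T \<longleftrightarrow>
     (\<forall>A. tail_set M T A \<longrightarrow> emeasure M A = 0 \<or> emeasure M (space M - A) = 0)"

text \<open>Essential images exist and form exactly one class modulo null sets, so the requirement
  that a function select an essential image of every measurable set is always satisfiable.\<close>

lemma essential_image_exists:
  assumes "sigma_finite_measure M" and np: "null_preserving M T" and A: "A \<in> sets M"
  shows "\<exists>A'. essential_image M T A A'"
proof -
  interpret sigma_finite_measure M by fact
  have T[measurable]: "T \<in> measurable M M"
    using np by (simp add: null_preserving_def)
  obtain h where h[measurable]: "h \<in> borel_measurable M" and hfin: "integral\<^sup>N M h \<noteq> \<infinity>"
    and hpos: "\<And>x. x \<in> space M \<Longrightarrow> 0 < h x"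
    using Ex_finite_integrable_function by auto
  define N where "N = density M h"
  have sN[simp, measurable_cong]: "sets N = sets M" by (simp add: N_def)
  interpret N: finite_measure N
    unfolding N_def using hfin h
    by (intro finite_measureI) (simp cong: nn_integral_cong emeasure_density)
  have null: "emeasure M B = 0" if "B \<in> sets M" "measure N B = 0" for B
  proof -
    have "B \<in> null_sets N"
      using that by (intro null_setsI) (auto simp: N.emeasure_eq_measure)
    then have "AE x in M. x \<in> B \<longrightarrow> h x = 0"
      unfolding N_def by (subst (asm) null_sets_density_iff) auto
    then have "AE x in M. x \<notin> B"
      by (rule AE_mp) (auto intro!: AE_I2 dest: hpos)
    then show ?thesis
      using that by (subst (asm) AE_iff_null_sets[symmetric]) auto
  qed
  define F where "F = {B \<in> sets M. ae_subset M A (T -` B \<inter> space M)}"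
  have F_sets: "B \<in> sets M" if "B \<in> F" for B using that by (simp add: F_def)
  have F_Inter: "(\<Inter>n::nat. B n) \<in> F" if B: "\<And>n. B n \<in> F" for B
  proof -
    have [measurable]: "B n \<in> sets M" for n using B by (rule F_sets)
    have "A - (T -` B n \<inter> space M) \<in> null_sets M" for n
      using B[of n] A by (intro null_setsI) (auto simp: F_def ae_subset_def)
    then have "(\<Union>n. A - (T -` B n \<inter> space M)) \<in> null_sets M"
      by (rule null_sets_UN)
    moreover have "(\<Union>n. A - (T -` B n \<inter> space M)) = A - (T -` (\<Inter>n. B n) \<inter> space M)"
      by auto
    ultimately show ?thesis
      by (auto simp: F_def ae_subset_def null_sets_def)
  qed
  have F_Int: "B \<inter> C \<in> F" if "B \<in> F" "C \<in> F" for B C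
  proof -
    have "(\<Inter>n::nat. if n = 0 then B else C) \<in> F"
      by (rule F_Inter) (use that in auto)
    moreover have "(\<Inter>n::nat. if n = 0 then B else C) = B \<inter> C"
      by (auto split: if_splits)
    ultimately show ?thesis by simp
  qed
  have "T -` space M \<inter> space M = space M"
    using measurable_space[OF T] by auto
  moreover have "emeasure M (A - space M) = 0"
    using sets.sets_into_space[OF A] by (metis Diff_eq_empty_iff emeasure_empty)
  ultimately have spF: "space M \<in> F"
    by (simp add: F_def ae_subset_def)
  define c where "c = Inf (measure N ` F)"
  have bdd: "bdd_below (measure N ` F)"
    by (rule bdd_belowI2[of _ 0]) simp
  have c_le: "c \<le> measure N B" if "B \<in> F" for B
    unfolding c_def using bdd that by (rule cINF_lower)
  have "\<exists>B\<in>F. measure N B < c + 1 / real (Suc n)" for n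
  proof -
    have "Inf (measure N ` F) < c + 1 / real (Suc n)" by (simp add: c_def)
    then show ?thesis using spF bdd by (subst (asm) cINF_less_iff) auto
  qed
  then obtain B where B: "\<And>n. B n \<in> F" "\<And>n. measure N (B n) < c + 1 / real (Suc n)"
    by metis
  define A' where "A' = (\<Inter>n. B n)"
  have A'F: "A' \<in> F" unfolding A'_def by (rule F_Inter) (rule B)
  have A'_le: "measure N A' \<le> c"
  proof (rule field_le_epsilon)
    fix e :: real assume "0 < e"
    then obtain n where n: "1 / real (Suc n) < e" using nat_approx_posE by metis
    have "measure N A' \<le> measure N (B n)"
      using F_sets[OF B(1)] by (intro N.finite_measure_mono) (auto simp: A'_def)
    then show "measure N A' \<le> c + e" using B(2)[of n] n by linarith
  qed
  have "ae_subset M A' C" if "C \<in> F" for C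
  proof -
    have "measure N (A' - C) = measure N A' - measure N (A' \<inter> C)"
      using F_sets[OF A'F] F_sets[OF that] by (intro N.finite_measure_Diff') auto
    then have "measure N (A' - C) \<le> 0"
      using A'_le c_le[OF F_Int[OF A'F that]] by linarith
    then have "measure N (A' - C) = 0"
      using measure_nonneg[of N "A' - C"] by linarith
    then show ?thesis
      unfolding ae_subset_def using F_sets[OF A'F] F_sets[OF that] by (intro null) auto
  qed
  then have "essential_image M T A A'"
    using A'F by (auto simp: essential_image_def F_def)
  then show ?thesis ..
qed

lemma essential_image_iff_ae_equal:
  assumes np: "null_preserving M T" and A: "A \<in> sets M"
    and A': "essential_image M T A A'" and B: "B \<in> sets M"
  shows "essential_image M T A B \<longleftrightarrow> ae_equal M A' B"
proof -
  have T[measurable]: "T \<in> measurable M M"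
    using np by (simp add: null_preserving_def)
  have A's: "A' \<in> sets M" using A' by (simp add: essential_image_def)
  have sub: "ae_subset M C D \<longleftrightarrow> (AE x in M. x \<in> C \<longrightarrow> x \<in> D)"
    if "C \<in> sets M" "D \<in> sets M" for C D
    unfolding ae_subset_def using that
    by (subst AE_iff_measurable[of "C - D"]) (auto dest: sets.sets_into_space)
  have eq: "ae_equal M A' B \<longleftrightarrow> ae_subset M A' B \<and> ae_subset M B A'"
  proof -
    have "(A' - B) \<union> (B - A') \<in> null_sets M \<longleftrightarrow> A' - B \<in> null_sets M \<and> B - A' \<in> null_sets M"
      using A's B null_sets_subset[of "(A' - B) \<union> (B - A')" M "A' - B"]
        null_sets_subset[of "(A' - B) \<union> (B - A')" M "B - A'"]
      by (auto intro: null_sets.Un)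
    then show ?thesis
      using A's B by (simp add: ae_equal_def ae_subset_def null_sets_def)
  qed
  show ?thesis
  proof
    assume "essential_image M T A B"
    then show "ae_equal M A' B"
      using A' unfolding eq essential_image_def by blast
  next
    assume "ae_equal M A' B"
    then have AB: "ae_subset M A' B" and BA: "ae_subset M B A'" by (auto simp: eq)
    have "emeasure M (T -` (A' - B) \<inter> space M) = 0"
      using np AB A's B unfolding null_preserving_def ae_subset_def by blast
    then have "ae_subset M (T -` A' \<inter> space M) (T -` B \<inter> space M)"
      by (simp add: ae_subset_def vimage_Diff Diff_Int_distrib2)
    then have "ae_subset M A (T -` B \<inter> space M)"
      using A' A A's B unfolding essential_image_def by (auto simp: sub)
    moreover have "ae_subset M B C" if "C \<in> sets M" "ae_subset M A (T -` C \<inter> space M)" for C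
    proof -
      have "ae_subset M A' C" using A' that by (simp add: essential_image_def)
      then show ?thesis using BA A's B that(1) by (auto simp: sub)
    qed
    ultimately show "essential_image M T A B"
      using B by (simp add: essential_image_def)
  qed
qed

end

theory Submission
  imports Defs
begin

text \<open>
  Write \<open>A\<^sub>n\<close> for the \<open>n\<close>-th essential image of \<open>A\<close>. Modulo null sets the pullbacks
  \<open>T\<^sup>-\<^sup>n A\<^sub>n\<close> increase with \<open>n\<close> and start at \<open>A\<close>, and their upper limit lies in every \<open>T\<^sup>-\<^sup>m \<A>\<close>; in an
  exact system it therefore has full measure as soon as \<open>A\<close> is not null, and by invariance of
  \<open>\<mu>\<close> we get \<open>\<mu>(A\<^sub>n) = \<mu>(T\<^sup>-\<^sup>n A\<^sub>n) \<rightarrow> 1\<close>. Conversely, if \<open>A\<close> agrees with \<open>T\<^sup>-\<^sup>n C\<^sub>n\<close> for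
  every \<open>n\<close>, then the \<open>n\<close>-th images of \<open>A\<close> and of its complement are essentially contained in the
  disjoint sets \<open>C\<^sub>n\<close> and its complement, so their \<open>\<mu>\<close>-measures cannot both tend to \<open>1\<close>.
\<close>

section \<open>Relations modulo null sets and iterates of a null-preserving map\<close>

lemma ae_subset_iff_AE:
  assumes "A \<in> sets M" "B \<in> sets M"
  shows "ae_subset M A B \<longleftrightarrow> (AE x in M. x \<in> A \<longrightarrow> x \<in> B)"
  unfolding ae_subset_def using assms
  by (subst AE_iff_measurable[of "A - B"]) (auto dest: sets.sets_into_space)

lemma ae_equal_iff_AE:
  assumes "A \<in> sets M" "B \<in> sets M"
  shows "ae_equal M A B \<longleftrightarrow> (AE x in M. x \<in> A \<longleftrightarrow> x \<in> B)"
  unfolding ae_equal_def using assms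
  by (subst AE_iff_measurable[of "(A - B) \<union> (B - A)"]) (auto dest: sets.sets_into_space)

text \<open>\<open>P\<close> need not be measurable, so a measurable null set covering its
  exceptions is pulled back instead.\<close>

lemma null_preserving_AE:
  assumes np: "null_preserving M T" and P: "AE x in M. P x"
  shows "AE x in M. P (T x)"
proof -
  have T: "T \<in> measurable M M" using np by (simp add: null_preserving_def)
  obtain N where N: "{x \<in> space M. \<not> P x} \<subseteq> N" "emeasure M N = 0" "N \<in> sets M"
    using P by (rule AE_E)
  show ?thesis
  proof (rule AE_I)
    show "{x \<in> space M. \<not> P (T x)} \<subseteq> T -` N \<inter> space M"
      using N(1) measurable_space[OF T] by auto
    show "emeasure M (T -` N \<inter> space M) = 0"
      using np N by (simp add: null_preserving_def)
    show "T -` N \<inter> space M \<in> sets M"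
      using T N(3) by (rule measurable_sets)
  qed
qed

lemma null_preserving_AE_funpow:
  assumes np: "null_preserving M T" and P: "AE x in M. P x"
  shows "AE x in M. P ((T ^^ n) x)"
proof (induction n)
  case (Suc n)
  show ?case using null_preserving_AE[OF np Suc] by (simp add: funpow_swap1)
qed (use P in simp)

lemma measurable_funpow:
  assumes "T \<in> measurable M M"
  shows "T ^^ n \<in> measurable M M"
proof (induction n)
  case (Suc n)
  show ?case unfolding funpow.simps using Suc assms by (rule measurable_comp)
qed (simp add: id_def)

lemma distr_funpow_eq:
  assumes T: "T \<in> measurable M M" and inv: "distr M M T = M"
  shows "distr M M (T ^^ n) = M"
proof (induction n)
  case (Suc n)
  have "distr M M (T ^^ Suc n) = distr (distr M M (T ^^ n)) M T"
    unfolding funpow.simps by (rule distr_distr[symmetric]) (rule T measurable_funpow[OF T])+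
  then show ?case by (simp only: Suc inv)
qed (simp add: id_def distr_id)

section \<open>Iterated essential images: minimality and growth of their pullbacks\<close>

lemma iterated_essential_image_sets:
  assumes "\<forall>A\<in>sets M. essential_image M T A (F A)" "A \<in> sets M"
  shows "(F ^^ n) A \<in> sets M"
  by (induction n) (use assms in \<open>auto simp: essential_image_def\<close>)

text \<open>Minimality of a single essential image is iterated: the preimage of \<open>C\<close>
  under \<open>T ^^ n\<close> is a competitor for \<open>F A\<close>, hence essentially contains it,
  and the induction continues from \<open>F A\<close>. This is why \<open>A\<close> is
  generalized.\<close>

lemma iterated_essential_image_least:
  assumes T: "T \<in> measurable M M" and F: "\<forall>A\<in>sets M. essential_image M T A (F A)"
    and "A \<in> sets M" and C: "C \<in> sets M" and "AE x in M. x \<in> A \<longrightarrow> (T ^^ n) x \<in> C"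
  shows "AE x in M. x \<in> (F ^^ n) A \<longrightarrow> x \<in> C"
  using assms(3,5)
proof (induction n arbitrary: A)
  case (Suc n)
  let ?C = "(T ^^ n) -` C \<inter> space M"
  have C': "?C \<in> sets M"
    using measurable_funpow[OF T] C by (rule measurable_sets)
  have FA: "F A \<in> sets M" and least: "\<And>B. B \<in> sets M \<Longrightarrow> ae_subset M A (T -` B \<inter> space M)
      \<Longrightarrow> ae_subset M (F A) B"
    using F Suc.prems(1) by (auto simp: essential_image_def)
  have "AE x in M. x \<in> A \<longrightarrow> x \<in> T -` ?C \<inter> space M"
    using Suc.prems(2) AE_space
    by eventually_elim (use measurable_space[OF T] in \<open>auto simp: funpow_swap1\<close>)
  then have "ae_subset M A (T -` ?C \<inter> space M)"
    using Suc.prems(1) measurable_sets[OF T C'] by (simp add: ae_subset_iff_AE)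
  then have "AE x in M. x \<in> F A \<longrightarrow> x \<in> ?C"
    using least[OF C'] FA C' by (simp add: ae_subset_iff_AE)
  then have "AE x in M. x \<in> F A \<longrightarrow> (T ^^ n) x \<in> C"
    by eventually_elim auto
  then have "AE x in M. x \<in> (F ^^ n) (F A) \<longrightarrow> x \<in> C"
    by (rule Suc.IH[OF FA])
  then show ?case by (simp add: funpow_swap1)
qed simp

text \<open>The defining inclusion of an essential image, applied to \<open>(F ^^ n) A\<close>, is
  transported along \<open>T ^^ n\<close>, because null sets pull back to null sets. Placing the
  quantifier over \<open>n\<close> inside yields one null set for all times, so later arguments can
  follow a single orbit.\<close>

lemma pullback_essential_images_mono:
  assumes np: "null_preserving M T" and F: "\<forall>A\<in>sets M. essential_image M T A (F A)"
    and A: "A \<in> sets M"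
  shows "AE x in M. \<forall>n. (T ^^ n) x \<in> (F ^^ n) A \<longrightarrow> (T ^^ Suc n) x \<in> (F ^^ Suc n) A"
proof -
  have T: "T \<in> measurable M M" using np by (simp add: null_preserving_def)
  have "AE x in M. x \<in> (F ^^ n) A \<longrightarrow> T x \<in> (F ^^ Suc n) A" for n
  proof -
    have An: "(F ^^ n) A \<in> sets M" "(F ^^ Suc n) A \<in> sets M"
      by (rule iterated_essential_image_sets[OF F A])+
    have "ae_subset M ((F ^^ n) A) (T -` ((F ^^ Suc n) A) \<inter> space M)"
      using F An(1) by (simp add: essential_image_def)
    then have "AE x in M. x \<in> (F ^^ n) A \<longrightarrow> x \<in> T -` ((F ^^ Suc n) A) \<inter> space M"
      using An measurable_sets[OF T An(2)] by (simp only: ae_subset_iff_AE)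
    then show ?thesis by eventually_elim auto
  qed
  then have "AE x in M. (T ^^ n) x \<in> (F ^^ n) A \<longrightarrow> T ((T ^^ n) x) \<in> (F ^^ Suc n) A" for n
    by (rule null_preserving_AE_funpow[OF np])
  then show ?thesis by (simp add: AE_all_countable)
qed

section \<open>Upper limits as tail sets, and the consequence of exactness\<close>

lemma frequently_sequentially_add:
  "(\<exists>\<^sub>F n in sequentially. P (n + k)) \<longleftrightarrow> (\<exists>\<^sub>F n in sequentially. P n)"
  by (simp add: frequently_def eventually_sequentially_seg[where P = "\<lambda>n. \<not> P n"])

text \<open>An upper limit ignores finitely many indices, so for every \<open>m\<close> membership
  of \<open>x\<close> can be decided from \<open>(T ^^ m) x\<close> alone.\<close>

lemma limsup_pullback_in_tail:
  fixes A :: "nat \<Rightarrow> 'a set"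
  assumes T: "T \<in> measurable M M" and A: "\<And>n. A n \<in> sets M"
  shows "{x \<in> space M. \<exists>\<^sub>F n in sequentially. (T ^^ n) x \<in> A n}
    \<in> (\<Inter>m. {(T ^^ m) -` C \<inter> space M | C. C \<in> sets M})"
proof
  fix m
  \<comment> \<open>The index of \<open>A\<close> is advanced by \<open>m\<close>, since the orbit
    of \<open>(T ^^ m) x\<close> at time \<open>n\<close> is the orbit of \<open>x\<close> at time
    \<open>n + m\<close>.\<close>
  let ?C = "{x \<in> space M. \<exists>\<^sub>F n in sequentially. (T ^^ n) x \<in> A (n + m)}"
  have [measurable]: "T ^^ n \<in> measurable M M" "A n \<in> sets M" for n
    using A measurable_funpow[OF T] by auto
  have "?C \<in> sets M"
    unfolding frequently_sequentially by measurable
  moreover have "{x \<in> space M. \<exists>\<^sub>F n in sequentially. (T ^^ n) x \<in> A n} = (T ^^ m) -` ?C \<inter> space M"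
    using measurable_space[OF measurable_funpow[OF T, of m]]
      frequently_sequentially_add[where k = m and P = "\<lambda>n. (T ^^ n) x \<in> A n" for x]
    by (auto simp: funpow_add)
  ultimately show "{x \<in> space M. \<exists>\<^sub>F n in sequentially. (T ^^ n) x \<in> A n}
      \<in> {(T ^^ m) -` C \<inter> space M | C. C \<in> sets M}"
    by blast
qed

text \<open>The upper limit \<open>L\<close> of the pullbacks is a tail set that essentially
  contains \<open>A\<close>, because an orbit starting in \<open>A\<close> almost surely lies in
  every image at the matching time. So \<open>L\<close> is not null, and exactness makes it
  full.\<close>

lemma exact_system_AE_orbit_in_images:
  assumes np: "null_preserving M T" and F: "\<forall>A\<in>sets M. essential_image M T A (F A)"
    and exact: "exact_system M T" and A: "A \<in> sets M" "emeasure M A > 0"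
  shows "AE x in M. \<exists>n. (T ^^ n) x \<in> (F ^^ n) A"
proof -
  have T: "T \<in> measurable M M" using np by (simp add: null_preserving_def)
  define L where "L = {x \<in> space M. \<exists>\<^sub>F n in sequentially. (T ^^ n) x \<in> (F ^^ n) A}"
  have tail: "L \<in> (\<Inter>m. {(T ^^ m) -` C \<inter> space M | C. C \<in> sets M})"
    unfolding L_def
    by (rule limsup_pullback_in_tail[OF T]) (rule iterated_essential_image_sets[OF F A(1)])
  \<comment> \<open>The case \<open>m = 0\<close> of the tail property yields measurability of
    \<open>L\<close>.\<close>
  then have "L \<in> {(T ^^ 0) -` C \<inter> space M | C. C \<in> sets M}" by blast
  then have L: "L \<in> sets M" by auto
  have "tail_set M T L"
    unfolding tail_set_def using L tail by (intro conjI bexI[of _ L]) (auto simp: ae_equal_def)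
  then have cases: "emeasure M L = 0 \<or> emeasure M (space M - L) = 0"
    using exact by (auto simp: exact_system_def)
  have "AE x in M. x \<in> A \<longrightarrow> x \<in> L"
    using pullback_essential_images_mono[OF np F A(1)] AE_space
  proof eventually_elim
    case (elim x)
    have "(T ^^ n) x \<in> (F ^^ n) A" if "x \<in> A" for n
      by (induction n) (use elim that in auto)
    then show ?case using elim by (auto simp: L_def)
  qed
  then have "emeasure M A \<le> emeasure M L"
    using L by (rule emeasure_mono_AE)
  then have "emeasure M (space M - L) = 0"
    using A(2) cases by auto
  then have "AE x in M. x \<notin> space M - L"
    using L by (intro AE_not_in null_setsI) auto
  then show ?thesis
    using AE_space by eventually_elim (auto simp: L_def dest: frequently_ex)
qed

lemma exact_system_measure_images_tendsto:
  assumes np: "null_preserving M T" and F: "\<forall>A\<in>sets M. essential_image M T A (F A)"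
    and exact: "exact_system M T" and A: "A \<in> sets M" "emeasure M A > 0"
    and "prob_space \<mu>" and sets: "sets \<mu> = sets M" and ac: "absolutely_continuous M \<mu>"
    and inv: "distr \<mu> \<mu> T = \<mu>"
  shows "(\<lambda>n. measure \<mu> ((F ^^ n) A)) \<longlonglongrightarrow> 1"
proof -
  interpret prob_space \<mu> by fact
  have T: "T \<in> measurable \<mu> \<mu>"
    using np by (simp add: null_preserving_def sets cong: measurable_cong_sets)
  note AE_mu = absolutely_continuous_AE[OF sets ac]
  let ?P = "\<lambda>n. (T ^^ n) -` ((F ^^ n) A) \<inter> space \<mu>"
  have An: "(F ^^ n) A \<in> events" for n
    using iterated_essential_image_sets[OF F A(1)] sets by simp
  have P: "?P n \<in> events" for n
    using measurable_funpow[OF T] An by (rule measurable_sets)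
  \<comment> \<open>The pullbacks increase only modulo null sets; their finite unions increase
    everywhere, so continuity from below applies.\<close>
  define U where "U n = (\<Union>k\<le>n. ?P k)" for n
  have U: "U n \<in> events" for n unfolding U_def using P by (intro sets.finite_UN) auto
  have "incseq U" unfolding U_def by (intro incseq_SucI UN_mono) auto
  then have "(\<lambda>n. prob (U n)) \<longlonglongrightarrow> prob (\<Union>n. U n)"
    using U by (intro finite_Lim_measure_incseq) auto
  moreover have "prob (\<Union>n. U n) = 1"
  proof -
    have "AE x in \<mu>. \<exists>n. (T ^^ n) x \<in> (F ^^ n) A"
      by (rule AE_mu) (rule exact_system_AE_orbit_in_images[OF np F exact A])
    then have "AE x in \<mu>. x \<in> (\<Union>n. U n)"
      using AE_space by eventually_elim (auto simp: U_def)
    then show ?thesis using U by (subst prob_eq_1) auto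
  qed
  moreover have "prob (U n) = prob ((F ^^ n) A)" for n
  proof -
    have "AE x in \<mu>. \<forall>n. (T ^^ n) x \<in> (F ^^ n) A \<longrightarrow> (T ^^ Suc n) x \<in> (F ^^ Suc n) A"
      by (rule AE_mu) (rule pullback_essential_images_mono[OF np F A(1)])
    \<comment> \<open>An orbit that is in the image at some time \<open>k\<close> stays in the later
      images, so the union reduces to its last member up to a null set.\<close>
    then have "AE x in \<mu>. x \<in> U n \<longleftrightarrow> x \<in> ?P n"
    proof eventually_elim
      case (elim x)
      have "(T ^^ n) x \<in> (F ^^ n) A" if "(T ^^ k) x \<in> (F ^^ k) A" "k \<le> n" for k
        using that(2,1) by (induction rule: dec_induct) (use elim in auto)
      then show ?case by (auto simp: U_def)
    qed
    then have "prob (U n) = prob (?P n)"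
      using U P by (intro finite_measure_eq_AE) auto
    also have "\<dots> = measure (distr \<mu> \<mu> (T ^^ n)) ((F ^^ n) A)"
      by (rule measure_distr[symmetric]) (rule measurable_funpow[OF T], rule An)
    also have "\<dots> = prob ((F ^^ n) A)"
      by (simp only: distr_funpow_eq[OF T inv])
    finally show ?thesis .
  qed
  ultimately show ?thesis by simp
qed

section \<open>From images of asymptotically full measure back to exactness\<close>

lemma exact_systemI_measure_images:
  assumes T: "T \<in> measurable M M" and F: "\<forall>A\<in>sets M. essential_image M T A (F A)"
    and "prob_space \<mu>" and sets: "sets \<mu> = sets M" and ac: "absolutely_continuous M \<mu>"
    and lim: "\<And>A. A \<in> sets M \<Longrightarrow> emeasure M A > 0 \<Longrightarrow> (\<lambda>n. measure \<mu> ((F ^^ n) A)) \<longlonglongrightarrow> 1"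
  shows "exact_system M T"
  unfolding exact_system_def
proof (intro allI impI, rule ccontr)
  fix A assume "tail_set M T A" and pos: "\<not> (emeasure M A = 0 \<or> emeasure M (space M - A) = 0)"
  then obtain B where A: "A \<in> sets M" and AB: "ae_equal M A B"
    and tail: "B \<in> (\<Inter>n. {(T ^^ n) -` C \<inter> space M | C. C \<in> sets M})"
    unfolding tail_set_def by (elim conjE bexE)
  have B: "\<exists>C\<in>sets M. B = (T ^^ n) -` C \<inter> space M" for n
    using INT_D[OF tail UNIV_I[of n]] by blast
  interpret prob_space \<mu> by fact
  note AE_mu = absolutely_continuous_AE[OF sets ac]
  let ?A' = "space M - A"
  have A': "?A' \<in> sets M" using A by auto
  have "B \<in> sets M" using B[of 0] by auto
  then have AB: "AE x in M. x \<in> A \<longleftrightarrow> x \<in> B"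
    using A AB by (simp add: ae_equal_iff_AE)
  have le: "prob ((F ^^ n) A) + prob ((F ^^ n) ?A') \<le> 1" for n
  proof -
    obtain C where C: "C \<in> sets M" and BC: "B = (T ^^ n) -` C \<inter> space M" using B by blast
    have C': "space M - C \<in> sets M" using C by auto
    have "AE x in M. x \<in> A \<longrightarrow> (T ^^ n) x \<in> C"
      using AB by eventually_elim (auto simp: BC)
    then have "AE x in M. x \<in> (F ^^ n) A \<longrightarrow> x \<in> C"
      by (rule iterated_essential_image_least[OF T F A C])
    then have 1: "prob ((F ^^ n) A) \<le> prob C"
      using C by (intro finite_measure_mono_AE AE_mu) (auto simp: sets)
    have "AE x in M. x \<in> ?A' \<longrightarrow> (T ^^ n) x \<in> space M - C"
      using AB
      by eventually_elim (use measurable_space[OF measurable_funpow[OF T]] in \<open>auto simp: BC\<close>)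
    then have "AE x in M. x \<in> (F ^^ n) ?A' \<longrightarrow> x \<in> space M - C"
      by (rule iterated_essential_image_least[OF T F A' C'])
    then have "prob ((F ^^ n) ?A') \<le> prob (space M - C)"
      using C' by (intro finite_measure_mono_AE AE_mu) (auto simp: sets)
    also have "\<dots> = 1 - prob C"
      using C prob_compl[of C] sets_eq_imp_space_eq[OF sets] by (simp add: sets)
    finally show ?thesis using 1 by simp
  qed
  \<comment> \<open>By \<open>pos\<close>, both \<open>A\<close> and its complement have positive
    measure, so \<open>lim\<close> applies to each of them.\<close>
  have "(\<lambda>n. prob ((F ^^ n) A) + prob ((F ^^ n) ?A')) \<longlonglongrightarrow> 1 + 1"
    using pos A A' by (intro tendsto_add lim) (auto simp: zero_less_iff_neq_zero)
  then have "(1 + 1 :: real) \<le> 1"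
    by (rule LIMSEQ_le_const2) (use le in auto)
  then show False by simp
qed

section \<open>Transfer of convergence from the invariant measure to an equivalent probability
  measure\<close>

text \<open>By Borel--Cantelli, the upper limit of counterexamples of summably small \<open>N\<close>-measure is
  \<open>N\<close>-null, hence \<open>M\<close>-null.\<close>

lemma absolutely_continuous_epsilon_delta:
  assumes "finite_measure M" "finite_measure N" and sets: "sets N = sets M"
    and ac: "absolutely_continuous N M" and e: "e > 0"
  shows "\<exists>d>0. \<forall>B\<in>sets M. measure N B < d \<longrightarrow> measure M B < e"
proof (rule ccontr)
  interpret M: finite_measure M by fact
  interpret N: finite_measure N by fact
  assume neg: "\<not> ?thesis"
  have "\<exists>B\<in>sets M. measure N B < (1/2) ^ n \<and> e \<le> measure M B" for n
  proof (rule ccontr)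
    assume "\<not> ?thesis"
    then have "\<forall>B\<in>sets M. measure N B < (1/2) ^ n \<longrightarrow> measure M B < e"
      by (auto simp: not_le)
    moreover have "(0::real) < (1/2) ^ n" by simp
    ultimately show False using neg by blast
  qed
  then obtain B where B: "\<And>n. B n \<in> sets M" "\<And>n. measure N (B n) < (1/2) ^ n"
    "\<And>n. e \<le> measure M (B n)"
    by metis
  have "summable (\<lambda>n. measure N (B n))"
    by (rule summable_comparison_test'[where g = "\<lambda>n. (1/2) ^ n"])
      (use B(2) in \<open>auto intro: less_imp_le summable_geometric\<close>)
  then have "limsup B \<in> null_sets N"
    by (intro borel_cantelli_limsup1) (auto simp: sets B(1) N.emeasure_eq_measure less_top[symmetric])
  then have null: "limsup B \<in> null_sets M"
    using ac by (auto simp: absolutely_continuous_def)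
  \<comment> \<open>Each \<open>U n\<close> contains \<open>B n\<close> and so has
    \<open>M\<close>-measure at least \<open>e\<close>; continuity from above passes this bound to
    the upper limit, which is null.\<close>
  define U where "U n = (\<Union>k\<in>{n..}. B k)" for n
  have "decseq U" unfolding U_def decseq_def by force
  moreover have U: "U n \<in> sets M" for n unfolding U_def using B(1) by auto
  ultimately have "(\<lambda>n. measure M (U n)) \<longlonglongrightarrow> measure M (\<Inter>n. U n)"
    by (intro M.finite_Lim_measure_decseq) auto
  moreover have "e \<le> measure M (U n)" for n
    using B(3)[of n] M.finite_measure_mono[of "B n" "U n"] U by (force simp: U_def)
  ultimately have "e \<le> measure M (\<Inter>n. U n)"
    by (intro LIMSEQ_le_const) auto
  moreover have "(\<Inter>n. U n) = limsup B"
    by (simp add: U_def limsup_INF_SUP)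
  ultimately show False
    using e null by (simp add: measure_eq_0_null_sets)
qed

text \<open>The complements of the \<open>B n\<close> have \<open>N\<close>-measure tending to 0,
  hence also \<open>M\<close>-measure tending to 0 by the epsilon-delta form of absolute
  continuity.\<close>

lemma absolutely_continuous_tendsto_full:
  assumes "prob_space M" "prob_space N" and sets: "sets N = sets M"
    and ac: "absolutely_continuous N M" and B: "\<And>n. B n \<in> sets M"
    and lim: "(\<lambda>n. measure N (B n)) \<longlonglongrightarrow> 1"
  shows "(\<lambda>n. measure M (B n)) \<longlonglongrightarrow> 1"
proof (rule LIMSEQ_I)
  interpret M: prob_space M by fact
  interpret N: prob_space N by fact
  fix e :: real assume "e > 0"
  then obtain d where d: "d > 0" "\<And>C. C \<in> sets M \<Longrightarrow> measure N C < d \<Longrightarrow> measure M C < e"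
    using absolutely_continuous_epsilon_delta[OF M.finite_measure_axioms N.finite_measure_axioms sets ac]
    by blast
  obtain n0 where n0: "\<And>n. n \<ge> n0 \<Longrightarrow> norm (measure N (B n) - 1) < d"
    using LIMSEQ_D[OF lim d(1)] by blast
  have "norm (measure M (B n) - 1) < e" if "n \<ge> n0" for n
  proof -
    have "measure N (space M - B n) = 1 - measure N (B n)"
      using N.prob_compl[of "B n"] B sets_eq_imp_space_eq[OF sets] by (simp add: sets)
    then have "measure M (space M - B n) < e"
      using n0[OF that] B by (intro d(2)) (auto simp: abs_if split: if_splits)
    then show ?thesis
      using M.prob_compl[OF B, of n] M.prob_le_1[of "B n"] \<open>e > 0\<close>
      unfolding real_norm_def by linarith
  qed
  then show "\<exists>n0. \<forall>n\<ge>n0. norm (measure M (B n) - 1) < e" by blast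
qed

theorem theorem5p6:
  fixes M \<mu> :: "'a measure" and T :: "'a \<Rightarrow> 'a" and That :: "'a set \<Rightarrow> 'a set"
  assumes "sigma_finite_measure M"
    and "null_preserving M T"
    and "prob_space \<mu>" and "sets \<mu> = sets M"
    and "absolutely_continuous M \<mu>"
    and "distr \<mu> \<mu> T = \<mu>"
    and "\<forall>A\<in>sets M. essential_image M T A (That A)"
  shows "(exact_system M T \<longleftrightarrow>
            (\<forall>A\<in>sets M. emeasure M A > 0 \<longrightarrow> (\<lambda>n. measure \<mu> ((That ^^ n) A)) \<longlonglongrightarrow> 1)) \<and>
         (exact_system M T \<and> absolutely_continuous \<mu> M \<and> emeasure M (space M) = 1 \<longrightarrow>
            (\<forall>A\<in>sets M. emeasure M A > 0 \<longrightarrow> (\<lambda>n. measure M ((That ^^ n) A)) \<longlonglongrightarrow> 1))"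
proof -
  have T: "T \<in> measurable M M" using assms(2) by (simp add: null_preserving_def)
  have lim: "(\<lambda>n. measure \<mu> ((That ^^ n) A)) \<longlonglongrightarrow> 1"
    if "exact_system M T" "A \<in> sets M" "emeasure M A > 0" for A
    using exact_system_measure_images_tendsto[OF assms(2,7) that assms(3-6)] .
  have "exact_system M T"
    if "\<forall>A\<in>sets M. emeasure M A > 0 \<longrightarrow> (\<lambda>n. measure \<mu> ((That ^^ n) A)) \<longlonglongrightarrow> 1"
    using that by (intro exact_systemI_measure_images[OF T assms(7,3-5)]) blast
  moreover have "(\<lambda>n. measure M ((That ^^ n) A)) \<longlonglongrightarrow> 1"
    if "exact_system M T" "absolutely_continuous \<mu> M" "emeasure M (space M) = 1"
      "A \<in> sets M" "emeasure M A > 0" for A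
    \<comment> \<open>The transfer lemma is used with \<open>\<mu>\<close> in the role of its
      \<open>N\<close>: \<open>absolutely_continuous \<mu> M\<close> says that
      \<open>\<mu>\<close>-null sets are \<open>M\<close>-null.\<close>
    using prob_spaceI[OF that(3)] assms(3,4) that(2)
      iterated_essential_image_sets[OF assms(7) that(4)] lim[OF that(1,4,5)]
    by (rule absolutely_continuous_tendsto_full)
  ultimately show ?thesis using lim by blast
qed

end
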